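(* Let $0\le p<1$ and let $f\in\Sigma(p)$ have the expansion $f(z)=\frac1{z-p}+\sum_{n=0}^\infty b_nz^n$ in $\mathbb{D}$. If there exists $k$, $0\le k<1$, such that $$\left|(z-p)^2f'(z)+1\right|\le\frac{k|z-p|^2}{(1+p)^2}\qquad\text{for all }z\in\mathbb{D},$$ then $f\in\Sigma_k(p)$.
   Context: $\mathbb{D}=\{|z|<1\}$, $\widehat{\mathbb{C}}=\mathbb{C}\cup\{\infty\}$, $\partial f=\partial f/\partial z$, $\bar\partial f=\partial f/\partial\bar z$. $\Sigma(p)$ is the class of univalent meromorphic functions $f$ on $\mathbb{D}$ with a simple pole at $z=p$ of residue $1$, so $f(z)=\frac1{z-p}+\sum_{n\ge0}b_nz^n$ on $\mathbb{D}$. $\Sigma_k(p)$ is the class of those $f\in\Sigma(p)$ having a $k$-quasiconformal extension to $\widehat{\mathbb{C}}$. A map $f:\widehat{\mathbb{C}}\to\widehat{\mathbb{C}}$ is $k$-quasiconformal if it is a homeomorphism with locally $L^2$ distributional derivatives on $\mathbb{C}\setminus\{f^{-1}(\infty)\}$ satisfying $|\bar\partial f|\le k|\partial f|$ a.e. At $z=p$ the expression $(z-p)^2f'(z)+1$ is understood by its removable-singularity value $0$. *)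

theory Defs
  imports "HOL-Analysis.Analysis" "HOL-Complex_Analysis.Complex_Analysis"
begin

text \<open>The Riemann sphere: \<open>Some z\<close> is the finite point \<open>z\<close>, and \<open>None\<close> is the point at infinity.\<close>

abbreviation riemann_sphere :: "complex option topology" where
  "riemann_sphere \<equiv> Alexandroff_compactification euclidean"

text \<open>A meromorphic function is represented by a map \<open>complex \<Rightarrow> complex\<close> whose value at a pole
  is the conventional \<open>0\<close> required by \<open>nicely_meromorphic_on\<close>; the following is the
  sphere-valued map it stands for.\<close>

definition sphere_map :: "(complex \<Rightarrow> complex) \<Rightarrow> complex \<Rightarrow> complex option" where
  "sphere_map f z = (if is_pole f z then None else Some (f z))"

definition Sigma_class :: "real \<Rightarrow> (complex \<Rightarrow> complex) set" where
  "Sigma_class p =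
    {f. f nicely_meromorphic_on ball 0 1
      \<and> inj_on (sphere_map f) (ball 0 1)
      \<and> is_pole f (of_real p) \<and> zorder f (of_real p) = -1
      \<and> residue f (of_real p) = 1}"

definition dir_deriv :: "complex \<Rightarrow> (complex \<Rightarrow> complex) \<Rightarrow> complex \<Rightarrow> complex" where
  "dir_deriv v \<phi> z = frechet_derivative \<phi> (at z) v"

text \<open>Differentiability here is over the reals, so \<open>Ck_smooth n\<close> is the class of \<open>n\<close> times
  continuously differentiable functions on the plane.\<close>

primrec Ck_smooth :: "nat \<Rightarrow> (complex \<Rightarrow> complex) \<Rightarrow> bool" where
  "Ck_smooth 0 \<phi> \<longleftrightarrow> continuous_on UNIV \<phi>"
| "Ck_smooth (Suc n) \<phi> \<longleftrightarrow>
    (\<forall>z. \<phi> differentiable (at z)) \<and> (\<forall>v. Ck_smooth n (dir_deriv v \<phi>))"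

definition test_function :: "complex set \<Rightarrow> (complex \<Rightarrow> complex) \<Rightarrow> bool" where
  "test_function \<Omega> \<phi> \<longleftrightarrow>
    (\<forall>n. Ck_smooth n \<phi>) \<and> compact (closure {z. \<phi> z \<noteq> 0}) \<and> closure {z. \<phi> z \<noteq> 0} \<subseteq> \<Omega>"

definition locally_L2 :: "complex set \<Rightarrow> (complex \<Rightarrow> complex) \<Rightarrow> bool" where
  "locally_L2 \<Omega> u \<longleftrightarrow>
    set_borel_measurable lborel \<Omega> u
    \<and> (\<forall>K. compact K \<and> K \<subseteq> \<Omega> \<longrightarrow> set_integrable lborel K (\<lambda>z. (cmod (u z))\<^sup>2))"

definition distributional_deriv ::
    "complex set \<Rightarrow> complex \<Rightarrow> (complex \<Rightarrow> complex) \<Rightarrow> (complex \<Rightarrow> complex) \<Rightarrow> bool" where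
  "distributional_deriv \<Omega> v g u \<longleftrightarrow>
    (\<forall>\<phi>. test_function \<Omega> \<phi> \<longrightarrow>
      (LINT z:\<Omega>|lborel. g z * dir_deriv v \<phi> z) = - (LINT z:\<Omega>|lborel. u z * \<phi> z))"

text \<open>With \<open>gx\<close>, \<open>gy\<close> the distributional partial derivatives of \<open>g\<close>, the Wirtinger derivatives
  are \<open>\<partial>g = (gx - \<i> gy) / 2\<close> and (conjugate variable) \<open>(gx + \<i> gy) / 2\<close>. The set \<open>\<Omega>\<close> is
  the plane without the preimage of infinity.\<close>

definition quasiconformal :: "real \<Rightarrow> (complex option \<Rightarrow> complex option) \<Rightarrow> bool" where
  "quasiconformal k F \<longleftrightarrow>
    homeomorphic_map riemann_sphere riemann_sphere F
    \<and> (let \<Omega> = {z. F (Some z) \<noteq> None}; g = (\<lambda>z. the (F (Some z))) in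
        \<exists>gx gy. locally_L2 \<Omega> gx \<and> locally_L2 \<Omega> gy
          \<and> distributional_deriv \<Omega> 1 g gx \<and> distributional_deriv \<Omega> \<i> g gy
          \<and> (AE z in lborel. z \<in> \<Omega> \<longrightarrow>
               cmod ((gx z + \<i> * gy z) / 2) \<le> k * cmod ((gx z - \<i> * gy z) / 2)))"

definition Sigma_qc_class :: "real \<Rightarrow> real \<Rightarrow> (complex \<Rightarrow> complex) set" where
  "Sigma_qc_class k p =
    {f \<in> Sigma_class p. \<exists>F. quasiconformal k F \<and> (\<forall>z\<in>ball 0 1. F (Some z) = sphere_map f z)}"

end

theory Submission
  imports Defs
begin

text \<open>Write \<open>f z = 1 / (z - p) + g z\<close> with \<open>g\<close> holomorphic in the unit disc. Since
  \<open>(z - p)\<^sup>2 f'(z) + 1 = (z - p)\<^sup>2 g'(z)\<close>, the hypothesis says that \<open>\<bar>g'\<bar> \<le> k / (1 + p)\<^sup>2\<close> off \<open>p\<close>,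
  and by continuity also at \<open>p\<close>. Hence \<open>g\<close> is
  Lipschitz with this constant and extends to the closed disc. The extension of \<open>f\<close> is the
  classical one by reflection: \<open>F z = 1 / (z - p) + g (1 / cnj z)\<close> for \<open>\<bar>z\<bar> > 1\<close>.

  That \<open>F\<close> is a homeomorphism becomes transparent in the coordinate \<open>w = 1 / (z - p)\<close>, which moves
  the pole to infinity: there \<open>F\<close> is \<open>w + H w\<close>, where \<open>H\<close> is \<open>g\<close> composed with the map
  \<open>reflected_preimage p\<close> that goes back to \<open>z\<close> and reflects it into the closed disc if necessary.
  This map of the plane is Lipschitz with constant \<open>(1 + p)\<^sup>2\<close>
  (\<open>lipschitz_on_reflected_preimage\<close>), and this is where the constant in the
  hypothesis comes from: \<open>H\<close> is \<open>k\<close>-Lipschitz on the whole plane. As \<open>k < 1\<close>, the identity plus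
  \<open>H\<close> is a homeomorphism of the plane by the contraction principle
  (\<open>identity_plus_contraction\<close>), and it extends to the sphere.

  Off the unit circle and \<open>p\<close> the map \<open>F\<close> is smooth. The modulus of its complex dilatation is \<open>0\<close>
  inside the circle, and outside it is
  \<open>\<bar>g'(1 / cnj z)\<bar> \<bar>z - p\<bar>\<^sup>2 / \<bar>z\<bar>\<^sup>2 \<le> k\<close>. The circle is a null set and \<open>F\<close> is locally Lipschitz away from
  \<open>p\<close>, so its pointwise derivatives are its distributional ones
  (\<open>distributional_deriv_if_AE_differentiable\<close>).\<close>

section \<open>Lipschitz maps and directional derivatives\<close>

lemma has_vector_derivative_along_line:
  assumes "(f has_derivative D) (at (x + t *\<^sub>R d))"
  shows "((\<lambda>t. f (x + t *\<^sub>R d)) has_vector_derivative D d) (at t)"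
proof -
  have "((\<lambda>t. f (x + t *\<^sub>R d)) has_derivative (\<lambda>s. D (s *\<^sub>R d))) (at t)"
    by (rule has_derivative_compose[of "\<lambda>t. x + t *\<^sub>R d", OF _ assms])
       (auto intro!: derivative_eq_intros)
  then show ?thesis
    using has_derivative_linear[OF assms] by (simp add: has_vector_derivative_def linear_cmul)
qed

lemma has_vector_derivative_tendsto:
  assumes "(g has_vector_derivative w) (at 0)"
  shows "((\<lambda>t. (g t - g 0) /\<^sub>R t) \<longlongrightarrow> w) (at 0)"
proof -
  have "((\<lambda>t. norm (g t - g 0 - t *\<^sub>R w) / norm t) \<longlongrightarrow> 0) (at 0)"
    using assms by (simp add: has_vector_derivative_def has_derivative_at)
  then have "((\<lambda>t. norm ((g t - g 0) /\<^sub>R t - w)) \<longlongrightarrow> 0) (at 0)"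
  proof (rule Lim_transform_eventually)
    have "norm (g t - g 0 - t *\<^sub>R w) / norm t = norm ((g t - g 0) /\<^sub>R t - w)" if "t \<noteq> 0" for t
    proof -
      have "(g t - g 0) /\<^sub>R t - w = (g t - g 0 - t *\<^sub>R w) /\<^sub>R t"
        using that by (simp add: scaleR_diff_right)
      then show ?thesis by (simp add: divide_inverse mult.commute)
    qed
    then show "\<forall>\<^sub>F t in at 0. norm (g t - g 0 - t *\<^sub>R w) / norm t = norm ((g t - g 0) /\<^sub>R t - w)"
      by (simp add: eventually_at_filter)
  qed
  then show ?thesis
    by (simp add: LIM_zero_cancel tendsto_norm_zero_iff)
qed

text \<open>The mean value inequality survives an exceptional set that every line meets in finitely many
  points, because the fundamental theorem of calculus on a segment tolerates finitely many points of
  non-differentiability of a continuous function.\<close>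

lemma lipschitz_on_UNIV_if_derivative_bounded_off_thin_set:
  fixes f :: "'a::real_normed_vector \<Rightarrow> 'b::banach"
  assumes cont: "continuous_on UNIV f"
    and thin: "\<And>a d. d \<noteq> 0 \<Longrightarrow> finite {t::real. a + t *\<^sub>R d \<in> S}"
    and deriv: "\<And>x. x \<notin> S \<Longrightarrow> \<exists>f'. (f has_derivative f') (at x) \<and> (\<forall>v. norm (f' v) \<le> L * norm v)"
    and "0 \<le> L"
  shows "L-lipschitz_on UNIV f"
proof (rule lipschitz_onI)
  fix x y :: 'a
  show "dist (f x) (f y) \<le> L * dist x y"
  proof (cases "x = y")
    case False
    define d where "d = y - x"
    obtain f' where f': "\<And>z. z \<notin> S \<Longrightarrow> (f has_derivative f' z) (at z)"
      "\<And>z v. z \<notin> S \<Longrightarrow> norm (f' z v) \<le> L * norm v"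
      using deriv by metis
    define T where "T = {t::real. x + t *\<^sub>R d \<in> S}"
    define h where "h t = (if t \<in> T then 0 else f' (x + t *\<^sub>R d) d)" for t
    have "finite T" unfolding T_def using thin False by (simp add: d_def)
    then have "(h has_integral (f (x + 1 *\<^sub>R d) - f (x + 0 *\<^sub>R d))) {0..1}"
    proof (rule fundamental_theorem_of_calculus_interior_strong)
      fix t assume "t \<in> {0<..<1} - T"
      then have "t \<notin> T" by blast
      then have "(f has_derivative f' (x + t *\<^sub>R d)) (at (x + t *\<^sub>R d))"
        using f' by (simp add: T_def)
      from has_vector_derivative_along_line[OF this]
      show "((\<lambda>t. f (x + t *\<^sub>R d)) has_vector_derivative h t) (at t)"
        using \<open>t \<notin> T\<close> by (simp add: h_def)
    next
      show "continuous_on {0..1} (\<lambda>t. f (x + t *\<^sub>R d))"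
        by (rule continuous_on_compose2[OF cont]) (auto intro!: continuous_intros)
    qed simp
    then have "norm (f (x + 1 *\<^sub>R d) - f (x + 0 *\<^sub>R d)) \<le> (L * norm d) * measure lborel {0..1::real}"
      by (rule has_integral_bound_real[where f = h and S = "{}", rotated 2])
         (use \<open>0 \<le> L\<close> f'(2) in \<open>auto simp: h_def T_def\<close>)
    then show ?thesis
      by (simp add: d_def dist_norm norm_minus_commute)
  qed simp
qed fact

text \<open>The difference quotients of \<open>u\<close> in direction \<open>v\<close> have integral \<open>0\<close> because Lebesgue measure is
  translation invariant; the Lipschitz bound and the compact support dominate them, so their limit
  has integral \<open>0\<close> as well.\<close>

lemma integral_directional_derivative_eq_0:
  fixes u :: "'a::euclidean_space \<Rightarrow> 'b::{banach, second_countable_topology}"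
  assumes lip: "L-lipschitz_on UNIV u"
    and K: "compact K" "\<And>z. z \<notin> K \<Longrightarrow> u z = 0"
    and w: "w \<in> borel_measurable lborel"
    and deriv: "AE z in lborel. \<exists>D. (u has_derivative D) (at z) \<and> D v = w z"
  shows "integrable lborel w" "integral\<^sup>L lborel w = 0"
proof -
  obtain B where B: "\<And>z. z \<in> K \<Longrightarrow> norm z \<le> B"
    using compact_imp_bounded[OF K(1)] by (auto simp: bounded_iff)
  define s where "s n z = real (Suc n) *\<^sub>R (u (z + v /\<^sub>R real (Suc n)) - u z)" for n z
  define b where "b z = indicator (cball 0 (B + norm v)) z * (L * norm v)" for z :: 'a
  have "continuous_on UNIV u" using lip by (rule lipschitz_on_continuous_on)
  then have u[measurable]: "u \<in> borel_measurable borel"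
    by (rule borel_measurable_continuous_onI)
  have "integrable lborel u"
  proof -
    have "integrable lborel (\<lambda>z. indicator K z *\<^sub>R u z)"
      by (rule borel_integrable_compact[OF K(1) continuous_on_subset[OF \<open>continuous_on UNIV u\<close>]]) simp
    also have "(\<lambda>z. indicator K z *\<^sub>R u z) = u"
      using K(2) by (auto simp: indicator_def)
    finally show ?thesis .
  qed
  have s_meas: "s n \<in> borel_measurable lborel" for n
    unfolding s_def by measurable
  have b_int: "integrable lborel b"
    unfolding b_def using emeasure_compact_finite[of "cball 0 (B + norm v)"]
    by (intro integrable_mult_left) (auto simp: less_top)
  have lim: "AE z in lborel. (\<lambda>n. s n z) \<longlonglongrightarrow> w z"
    using deriv
  proof eventually_elim
    fix z assume "\<exists>D. (u has_derivative D) (at z) \<and> D v = w z"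
    then obtain D where D: "(u has_derivative D) (at z)" "D v = w z" by blast
    have *: "((\<lambda>t. (u (z + t *\<^sub>R v) - u z) /\<^sub>R t) \<longlongrightarrow> w z) (at 0)"
      using has_vector_derivative_tendsto[OF has_vector_derivative_along_line[of u D z 0 v]] D by simp
    have "filterlim (\<lambda>n. inverse (real (Suc n))) (at 0) sequentially"
      by (intro filterlim_atI LIMSEQ_inverse_real_of_nat) auto
    from filterlim_compose[OF * this] show "(\<lambda>n. s n z) \<longlonglongrightarrow> w z"
      by (simp add: s_def)
  qed
  have bound: "AE z in lborel. norm (s n z) \<le> b z" for n
  proof (rule AE_I2)
    fix z
    show "norm (s n z) \<le> b z"
    proof (cases "norm z \<le> B + norm v")
      case True
      have "norm (u (z + v /\<^sub>R real (Suc n)) - u z) \<le> L * norm (v /\<^sub>R real (Suc n))"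
        using lipschitz_on_normD[OF lip, of "z + v /\<^sub>R real (Suc n)" z] by simp
      then have "real (Suc n) * norm (u (z + v /\<^sub>R real (Suc n)) - u z) \<le> L * norm v"
        by (simp add: field_simps)
      then show ?thesis using True by (simp add: s_def b_def)
    next
      case False
      have "norm (v /\<^sub>R real (Suc n)) \<le> norm v"
        by (simp add: field_simps mult_le_cancel_left1)
      then have "norm (z + v /\<^sub>R real (Suc n)) > B"
        using False norm_diff_ineq[of z "v /\<^sub>R real (Suc n)"] by linarith
      moreover have "norm z > B" using False norm_ge_zero[of v] by linarith
      ultimately have "u z = 0" "u (z + v /\<^sub>R real (Suc n)) = 0"
        using B K(2) by (meson linorder_not_le)+
      then show ?thesis using False by (simp add: s_def b_def)
    qed
  qed
  have "integral\<^sup>L lborel (s n) = 0" for n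
  proof -
    have shift: "integral\<^sup>L lborel (\<lambda>z. u (z + c)) = integral\<^sup>L lborel u"
      "integrable lborel (\<lambda>z. u (z + c))" for c
      using integral_distr[of "(+) c" lborel borel u] integrable_distr_eq[of "(+) c" lborel borel u]
        \<open>integrable lborel u\<close>
      by (simp_all add: lborel_distr_plus add.commute)
    show ?thesis
      unfolding s_def[abs_def] using shift \<open>integrable lborel u\<close> by simp
  qed
  with integral_dominated_convergence[OF w s_meas b_int lim bound]
  show "integral\<^sup>L lborel w = 0"
    by (simp add: LIMSEQ_const_iff)
  show "integrable lborel w"
    by (rule integrable_dominated_convergence[OF w s_meas b_int lim bound])
qed

section \<open>Distributional derivatives of locally Lipschitz functions\<close>

lemma eq_0_off_support: "z \<notin> closure {z. f z \<noteq> 0} \<Longrightarrow> f z = 0"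
  using closure_subset[of "{z. f z \<noteq> 0}"] by auto

lemma has_derivative_0_off_closed:
  assumes "closed K" "\<And>z. z \<notin> K \<Longrightarrow> f z = 0" "z \<notin> K"
  shows "(f has_derivative (\<lambda>_. 0)) (at z)"
  by (rule has_derivative_transform_within_open[of "\<lambda>_. 0" _ _ _ "- K"]) (use assms in auto)

lemma test_function_C1:
  assumes "test_function \<Omega> \<phi>"
  shows "(\<phi> has_derivative (\<lambda>v. dir_deriv v \<phi> z)) (at z)"
    and "continuous_on UNIV (dir_deriv v \<phi>)"
    and "continuous_on UNIV \<phi>"
proof -
  have "Ck_smooth (Suc 0) \<phi>" using assms unfolding test_function_def by blast
  then show "(\<phi> has_derivative (\<lambda>v. dir_deriv v \<phi> z)) (at z)"
    and "continuous_on UNIV (dir_deriv v \<phi>)"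
    by (auto simp: dir_deriv_def frechet_derivative_works)
  have "Ck_smooth 0 \<phi>" using assms unfolding test_function_def by blast
  then show "continuous_on UNIV \<phi>" by simp
qed

text \<open>The partial derivatives are continuous with compact support, hence bounded.\<close>

lemma test_function_lipschitz:
  assumes "test_function \<Omega> \<phi>"
  shows "\<exists>L. L-lipschitz_on UNIV \<phi>"
proof -
  define K where "K = closure {z. \<phi> z \<noteq> 0}"
  note C1 = test_function_C1[OF assms]
  have "compact K" using assms by (simp add: K_def test_function_def)
  have bounded: "\<exists>M. \<forall>z. norm (dir_deriv v \<phi> z) \<le> M" for v
  proof -
    have "compact (dir_deriv v \<phi> ` K)"
      by (rule compact_continuous_image[OF continuous_on_subset[OF C1(2)] \<open>compact K\<close>]) simp
    from compact_imp_bounded[OF this] obtain M where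
      M: "\<And>z. z \<in> K \<Longrightarrow> norm (dir_deriv v \<phi> z) \<le> M"
      unfolding bounded_iff by auto
    have \<phi>0: "\<phi> z = 0" if "z \<notin> K" for z
      using that unfolding K_def by (rule eq_0_off_support)
    have "dir_deriv v \<phi> z = 0" if "z \<notin> K" for z
      using has_derivative_unique[OF C1(1)
          has_derivative_0_off_closed[OF compact_imp_closed[OF \<open>compact K\<close>] \<phi>0 that]]
      by (simp add: fun_eq_iff)
    then have "norm (dir_deriv v \<phi> z) \<le> \<bar>M\<bar>" for z
      using M[of z] by (cases "z \<in> K") auto
    then show ?thesis by blast
  qed
  from bounded[of 1] bounded[of \<i>] obtain M N where
    M: "\<And>z. norm (dir_deriv 1 \<phi> z) \<le> M" and N: "\<And>z. norm (dir_deriv \<i> \<phi> z) \<le> N"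
    by blast
  have "0 \<le> M + N" using order_trans[OF norm_ge_zero M[of 0]] order_trans[OF norm_ge_zero N[of 0]] by linarith
  have bound: "norm (dir_deriv v \<phi> z) \<le> (M + N) * norm v" for v z
  proof -
    interpret bounded_linear "\<lambda>v. dir_deriv v \<phi> z"
      using C1(1) by (rule has_derivative_bounded_linear)
    have "Re v *\<^sub>R 1 + Im v *\<^sub>R \<i> = v" by (simp add: complex_eq_iff)
    moreover have "dir_deriv (Re v *\<^sub>R 1 + Im v *\<^sub>R \<i>) \<phi> z
        = Re v *\<^sub>R dir_deriv 1 \<phi> z + Im v *\<^sub>R dir_deriv \<i> \<phi> z"
      by (simp only: add scaleR)
    ultimately have "dir_deriv v \<phi> z = Re v *\<^sub>R dir_deriv 1 \<phi> z + Im v *\<^sub>R dir_deriv \<i> \<phi> z"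
      by (simp only:)
    also have "norm \<dots> \<le> norm v * M + norm v * N"
      by (intro norm_triangle_mono) (auto intro!: mult_mono M N abs_Re_le_cmod abs_Im_le_cmod)
    finally show ?thesis by (simp add: algebra_simps)
  qed
  have "(M + N)-lipschitz_on UNIV \<phi>"
  proof (rule lipschitz_on_UNIV_if_derivative_bounded_off_thin_set[where S = "{}"])
    show "\<exists>f'. (\<phi> has_derivative f') (at z) \<and> (\<forall>v. norm (f' v) \<le> (M + N) * norm v)" for z
      using C1(1) bound by blast
  qed (use C1(3) \<open>0 \<le> M + N\<close> in auto)
  then show ?thesis ..
qed

text \<open>For a test function \<open>\<phi>\<close> the product \<open>g \<phi>\<close>, extended by \<open>0\<close>, is globally Lipschitz with compact
  support, and the Leibniz rule holds for it almost everywhere. The defining identity of the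
  distributional derivative is therefore the vanishing of the integral of a directional derivative.\<close>

lemma distributional_deriv_if_AE_differentiable:
  assumes "open \<Omega>"
    and lip: "\<And>K. compact K \<Longrightarrow> K \<subseteq> \<Omega> \<Longrightarrow> \<exists>L. L-lipschitz_on K g"
    and meas: "set_borel_measurable lborel \<Omega> w"
    and deriv: "AE z in lborel. z \<in> \<Omega> \<longrightarrow> (\<exists>D. (g has_derivative D) (at z) \<and> D v = w z)"
  shows "distributional_deriv \<Omega> v g w"
  unfolding distributional_deriv_def
proof (intro allI impI)
  fix \<phi> assume test: "test_function \<Omega> \<phi>"
  note C1 = test_function_C1[OF test]
  define K where "K = closure {z. \<phi> z \<noteq> 0}"
  have K: "compact K" "K \<subseteq> \<Omega>" using test by (auto simp: K_def test_function_def)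
  have \<phi>0: "\<phi> z = 0" if "z \<notin> K" for z
    using that unfolding K_def by (rule eq_0_off_support)
  have "closed K" using compact_imp_closed[OF K(1)] .
  have \<phi>'0: "dir_deriv v \<phi> z = 0" if "z \<notin> K" for z
    using has_derivative_unique[OF C1(1) has_derivative_0_off_closed[OF \<open>closed K\<close> \<phi>0 that]]
    by (simp add: fun_eq_iff)
  obtain L where L: "L-lipschitz_on K g" using lip K by blast
  obtain M where M: "M-lipschitz_on UNIV \<phi>" using test_function_lipschitz[OF test] by blast
  have contg: "continuous_on K g" using L by (rule lipschitz_on_continuous_on)
  obtain B where B: "0 < B" "\<And>z. z \<in> K \<Longrightarrow> norm (g z) \<le> B"
    using compact_imp_bounded[OF compact_continuous_image[OF contg K(1)]]
    unfolding bounded_pos by blast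
  obtain C where C: "0 < C" "\<And>z. z \<in> K \<Longrightarrow> norm (\<phi> z) \<le> C"
    using compact_imp_bounded[OF compact_continuous_image[OF continuous_on_subset[OF C1(3) subset_UNIV] K(1)]]
    unfolding bounded_pos by blast
  define u where "u z = g z * \<phi> z" for z
  have "0 \<le> L" "0 \<le> M" using L M lipschitz_on_nonneg by auto
  \<comment> \<open>Outside \<open>K\<close> no uniform bound on \<open>g\<close> is at hand, so in each increment the value of \<open>g\<close> is taken at a point
    of \<open>K\<close>.\<close>
  have u_lip: "norm (u x - u y) \<le> (B * M + L * C) * norm (x - y)" if "x \<in> K" for x y
  proof -
    have 1: "norm (g x * (\<phi> x - \<phi> y)) \<le> B * (M * norm (x - y))"
      unfolding norm_mult using B that lipschitz_on_normD[OF M] by (intro mult_mono) auto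
    have 2: "norm ((g x - g y) * \<phi> y) \<le> L * norm (x - y) * C"
    proof (cases "y \<in> K")
      case True
      then show ?thesis
        unfolding norm_mult using C that lipschitz_on_normD[OF L] \<open>0 \<le> L\<close> by (intro mult_mono) auto
    next
      case False
      then show ?thesis using \<phi>0 C \<open>0 \<le> L\<close> by simp
    qed
    have "u x - u y = g x * (\<phi> x - \<phi> y) + (g x - g y) * \<phi> y"
      by (simp add: u_def algebra_simps)
    then have "norm (u x - u y) \<le> B * (M * norm (x - y)) + L * norm (x - y) * C"
      using norm_triangle_mono[OF 1 2] by simp
    then show ?thesis by (simp add: algebra_simps)
  qed
  have u: "(B * M + L * C)-lipschitz_on UNIV u"
  proof (rule lipschitz_onI)
    fix x y
    consider "x \<in> K" | "y \<in> K" | "x \<notin> K" "y \<notin> K" by blast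
    then show "dist (u x) (u y) \<le> (B * M + L * C) * dist x y"
    proof cases
      case 1 then show ?thesis using u_lip by (simp add: dist_norm)
    next
      case 2 then show ?thesis using u_lip[of y x] by (simp add: dist_norm norm_minus_commute)
    next
      case 3 then show ?thesis using \<phi>0 B C \<open>0 \<le> L\<close> \<open>0 \<le> M\<close> by (simp add: u_def)
    qed
  qed (use B C \<open>0 \<le> L\<close> \<open>0 \<le> M\<close> in auto)
  define a where "a z = indicator \<Omega> z *\<^sub>R (w z * \<phi> z)" for z
  define b where "b z = indicator \<Omega> z *\<^sub>R (g z * dir_deriv v \<phi> z)" for z
  have "integrable lborel (\<lambda>z. indicator K z *\<^sub>R (g z * dir_deriv v \<phi> z))"
    by (intro borel_integrable_compact K continuous_on_mult contg continuous_on_subset[OF C1(2)]) simp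
  also have "(\<lambda>z. indicator K z *\<^sub>R (g z * dir_deriv v \<phi> z)) = b"
    using \<phi>'0 K(2) by (auto simp: b_def fun_eq_iff split: split_indicator)
  finally have b_int: "integrable lborel b" .
  have "(\<lambda>z. (indicator \<Omega> z *\<^sub>R w z) * \<phi> z) \<in> borel_measurable lborel"
    using meas borel_measurable_continuous_onI[OF C1(3)]
    by (intro borel_measurable_times) (auto simp: set_borel_measurable_def)
  then have a_meas: "a \<in> borel_measurable lborel"
    by (simp add: a_def[abs_def])
  have u_deriv: "AE z in lborel. \<exists>D. (u has_derivative D) (at z) \<and> D v = a z + b z"
    using deriv
  proof eventually_elim
    fix z assume z: "z \<in> \<Omega> \<longrightarrow> (\<exists>D. (g has_derivative D) (at z) \<and> D v = w z)"
    show "\<exists>D. (u has_derivative D) (at z) \<and> D v = a z + b z"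
    proof (cases "z \<in> \<Omega>")
      case True
      then obtain D where D: "(g has_derivative D) (at z)" "D v = w z" using z by blast
      have "(u has_derivative (\<lambda>h. g z * dir_deriv h \<phi> z + D h * \<phi> z)) (at z)"
        unfolding u_def[abs_def] by (rule has_derivative_mult[OF D(1) C1(1)])
      then show ?thesis using D True by (auto simp: a_def b_def)
    next
      case False
      then have "z \<notin> K" using K(2) by blast
      then have "(u has_derivative (\<lambda>_. 0)) (at z)"
        by (rule has_derivative_0_off_closed[OF \<open>closed K\<close>, rotated]) (simp add: u_def \<phi>0)
      then show ?thesis using False by (auto simp: a_def b_def)
    qed
  qed
  have u0: "u z = 0" if "z \<notin> K" for z using \<phi>0[OF that] by (simp add: u_def)
  have ab_meas: "(\<lambda>z. a z + b z) \<in> borel_measurable lborel"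
    using a_meas borel_measurable_integrable[OF b_int] by (rule borel_measurable_add)
  note ab = integral_directional_derivative_eq_0[OF u K(1) u0 ab_meas u_deriv]
  have "integrable lborel a"
    using Bochner_Integration.integrable_diff[OF ab(1) b_int] by simp
  then have "integral\<^sup>L lborel a + integral\<^sup>L lborel b = 0"
    using ab(2) b_int by simp
  then show "(LINT z:\<Omega>|lborel. g z * dir_deriv v \<phi> z) = - (LINT z:\<Omega>|lborel. w z * \<phi> z)"
    unfolding set_lebesgue_integral_def a_def[symmetric] b_def[symmetric]
    using add_eq_0_iff by blast
qed

lemma locally_L2_if_bounded:
  assumes meas: "set_borel_measurable lborel \<Omega> w"
    and h: "continuous_on \<Omega> h" "\<And>z. z \<in> \<Omega> \<Longrightarrow> norm (w z) \<le> h z"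
  shows "locally_L2 \<Omega> w"
  unfolding locally_L2_def
proof (intro conjI allI impI)
  fix K assume K: "compact K \<and> K \<subseteq> \<Omega>"
  have "K \<in> sets lborel" using K by (simp add: borel_compact)
  have "set_borel_measurable lborel K w"
    using set_borel_measurable_subset[OF meas \<open>K \<in> sets lborel\<close>] K by blast
  then have "(\<lambda>z. (norm (indicator K z *\<^sub>R w z))\<^sup>2) \<in> borel_measurable lborel"
    unfolding set_borel_measurable_def by measurable
  also have "(\<lambda>z. (norm (indicator K z *\<^sub>R w z))\<^sup>2) = (\<lambda>z. indicator K z *\<^sub>R (norm (w z))\<^sup>2)"
    by (auto simp: indicator_def)
  finally have m: "set_borel_measurable lborel K (\<lambda>z. (norm (w z))\<^sup>2)"
    by (simp add: set_borel_measurable_def)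
  have "set_integrable lborel K (\<lambda>z. (h z)\<^sup>2)"
    unfolding set_integrable_def using K
    by (intro borel_integrable_compact continuous_on_power continuous_on_subset[OF h(1)]) auto
  then show "set_integrable lborel K (\<lambda>z. (cmod (w z))\<^sup>2)"
    by (rule set_integrable_bound[OF _ m]) (use h(2) K in \<open>auto intro!: AE_I2 power_mono\<close>)
qed fact

text \<open>Off the preimage of infinity the distributional derivatives of such a map are its pointwise ones,
  so quasiconformality can be read off from the pointwise Wirtinger derivatives \<open>A\<close> and \<open>B\<close>. The
  continuous majorant \<open>h\<close> makes them locally bounded, hence locally square integrable.\<close>

lemma quasiconformal_if_locally_lipschitz:
  assumes homeo: "homeomorphic_map riemann_sphere riemann_sphere F"
    and \<Omega>: "{z. F (Some z) \<noteq> None} = \<Omega>" and G: "\<And>z. G z = the (F (Some z))"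
    and "open \<Omega>"
    and lip: "\<And>K. compact K \<Longrightarrow> K \<subseteq> \<Omega> \<Longrightarrow> \<exists>L. L-lipschitz_on K G"
    and deriv: "AE z in lborel. z \<in> \<Omega> \<longrightarrow> (G has_derivative (\<lambda>v. A z * v + B z * cnj v)) (at z)"
    and [measurable]: "A \<in> borel_measurable borel" "B \<in> borel_measurable borel"
    and h: "continuous_on \<Omega> h" "\<And>z. z \<in> \<Omega> \<Longrightarrow> cmod (A z) + cmod (B z) \<le> h z"
    and dilatation: "\<And>z. z \<in> \<Omega> \<Longrightarrow> cmod (B z) \<le> k * cmod (A z)"
  shows "quasiconformal k F"
proof -
  have G': "G = (\<lambda>z. the (F (Some z)))" using G by (simp add: fun_eq_iff)
  have meas: "set_borel_measurable lborel \<Omega> (\<lambda>z. A z * v + B z * cnj v)" for v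
  proof -
    note [measurable] = borel_open[OF \<open>open \<Omega>\<close>]
    show ?thesis unfolding set_borel_measurable_def by measurable
  qed
  have L2: "locally_L2 \<Omega> (\<lambda>z. A z * v + B z * cnj v)" if "cmod v = 1" for v
  proof (rule locally_L2_if_bounded[OF meas h(1)])
    fix z assume "z \<in> \<Omega>"
    then show "cmod (A z * v + B z * cnj v) \<le> h z"
      using h(2)[of z] that norm_triangle_ineq[of "A z * v" "B z * cnj v"] by (simp add: norm_mult)
  qed
  have dir: "AE z in lborel. z \<in> \<Omega> \<longrightarrow> (\<exists>D. (G has_derivative D) (at z) \<and> D v = A z * v + B z * cnj v)"
    for v
    using deriv
  proof eventually_elim
    case (elim z)
    then show ?case by (intro impI exI[of _ "\<lambda>v. A z * v + B z * cnj v"]) simp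
  qed
  show ?thesis
    unfolding quasiconformal_def Let_def \<Omega> G'[symmetric]
  proof (intro conjI homeo exI)
    show "locally_L2 \<Omega> (\<lambda>z. A z * 1 + B z * cnj 1)" "locally_L2 \<Omega> (\<lambda>z. A z * \<i> + B z * cnj \<i>)"
      by (rule L2, simp)+
    show "distributional_deriv \<Omega> 1 G (\<lambda>z. A z * 1 + B z * cnj 1)"
      "distributional_deriv \<Omega> \<i> G (\<lambda>z. A z * \<i> + B z * cnj \<i>)"
      by (rule distributional_deriv_if_AE_differentiable[OF \<open>open \<Omega>\<close> _ meas dir], rule lip, assumption+)+
    have eq: "(A z * 1 + B z * cnj 1 + \<i> * (A z * \<i> + B z * cnj \<i>)) / 2 = B z"
      "(A z * 1 + B z * cnj 1 - \<i> * (A z * \<i> + B z * cnj \<i>)) / 2 = A z" for z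
      by (simp_all add: algebra_simps)
    show "AE z in lborel. z \<in> \<Omega> \<longrightarrow>
      cmod ((A z * 1 + B z * cnj 1 + \<i> * (A z * \<i> + B z * cnj \<i>)) / 2)
        \<le> k * cmod ((A z * 1 + B z * cnj 1 - \<i> * (A z * \<i> + B z * cnj \<i>)) / 2)"
      unfolding eq by (simp add: dilatation)
  qed
qed

section \<open>Homeomorphisms of the Riemann sphere\<close>

text \<open>The continuity proofs on the sphere go through this form, which involves only the topology and the
  bounded sets of the plane.\<close>

lemma openin_riemann_sphere:
  "openin riemann_sphere U \<longleftrightarrow>
     open {z. Some z \<in> U} \<and> (None \<in> U \<longrightarrow> bounded {z. Some z \<notin> U})"
proof
  assume "openin riemann_sphere U"
  then consider V where "open V" "U = Some ` V"
    | C where "compact C" "U = insert None (Some ` (- C))"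
    by (auto simp: openin_Alexandroff_compactification Compl_eq_Diff_UNIV)
  then show "open {z. Some z \<in> U} \<and> (None \<in> U \<longrightarrow> bounded {z. Some z \<notin> U})"
  proof cases
    case 1
    then show ?thesis by (auto simp: image_iff)
  next
    case 2
    then have "{z. Some z \<in> U} = - C" "{z. Some z \<notin> U} = C" by auto
    with 2 show ?thesis by (simp add: compact_imp_bounded compact_imp_closed open_Compl)
  qed
next
  assume U: "open {z. Some z \<in> U} \<and> (None \<in> U \<longrightarrow> bounded {z. Some z \<notin> U})"
  show "openin riemann_sphere U"
  proof (cases "None \<in> U")
    case False
    then have "U = Some ` {z. Some z \<in> U}"
      by (intro set_eqI, case_tac x) auto
    then show ?thesis
      using U by (metis openin_Alexandroff_compactification_image_Some open_openin)
  next
    case True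
    define C where "C = {z. Some z \<notin> U}"
    have "- C = {z. Some z \<in> U}" by (auto simp: C_def)
    then have "closed C" using U by (simp add: closed_def)
    moreover have "bounded C" using U True by (simp add: C_def)
    moreover have "U = insert None (Some ` (- C))"
      using True by (intro set_eqI, case_tac x) (auto simp: C_def)
    ultimately show ?thesis
      unfolding openin_Alexandroff_compactification
      by (intro disjI2 exI[of _ C]) (auto simp: compact_eq_bounded_closed Compl_eq_Diff_UNIV)
  qed
qed

lemma homeomorphic_map_riemann_sphere_if_continuous_bij:
  assumes "bij F"
    and "\<And>U. openin riemann_sphere U \<Longrightarrow> openin riemann_sphere (F -` U)"
  shows "homeomorphic_map riemann_sphere riemann_sphere F"
proof (rule continuous_imp_homeomorphic_map)
  have top: "topspace riemann_sphere = UNIV"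
    by (auto simp: image_iff)
  show "continuous_map riemann_sphere riemann_sphere F"
    using assms(2) unfolding continuous_map_def top by (simp add: vimage_def)
  show "F ` topspace riemann_sphere = topspace riemann_sphere" "inj_on F (topspace riemann_sphere)"
    using assms(1) by (simp_all only: top bij_def)
qed (simp_all add: Hausdorff_space_Alexandroff_compactification locally_compact_space_euclidean)

text \<open>A proper homeomorphism of the plane extends to the sphere by fixing infinity.\<close>

lemma homeomorphic_map_map_option:
  assumes "bij \<Phi>" "continuous_on UNIV \<Phi>" "\<And>B. bounded B \<Longrightarrow> bounded (\<Phi> -` B)"
  shows "homeomorphic_map riemann_sphere riemann_sphere (map_option \<Phi>)"
proof (rule homeomorphic_map_riemann_sphere_if_continuous_bij)
  have "map_option (inv \<Phi>) \<circ> map_option \<Phi> = id" "map_option \<Phi> \<circ> map_option (inv \<Phi>) = id"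
    using assms(1) by (simp_all add: fun_eq_iff option.map_comp bij_is_inj bij_is_surj
        surj_iff[symmetric] option.map_ident o_def surj_f_inv_f inv_f_f)
  then show "bij (map_option \<Phi>)" using o_bij by blast
next
  fix U assume "openin riemann_sphere U"
  then have U: "open {z. Some z \<in> U}" "None \<in> U \<Longrightarrow> bounded {z. Some z \<notin> U}"
    by (auto simp: openin_riemann_sphere)
  have "open (\<Phi> -` {z. Some z \<in> U})"
    by (rule continuous_open_vimage[OF U(1)]) (use assms(2) in \<open>simp add: continuous_on_eq_continuous_at\<close>)
  moreover have "bounded (\<Phi> -` {z. Some z \<notin> U})" if "None \<in> U"
    using assms(3) U(2) that by blast
  ultimately show "openin riemann_sphere (map_option \<Phi> -` U)"
    by (simp add: openin_riemann_sphere vimage_def)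
qed

definition inversion_at :: "complex \<Rightarrow> complex option \<Rightarrow> complex option" where
  "inversion_at p x =
    (case x of None \<Rightarrow> Some 0 | Some z \<Rightarrow> if z = p then None else Some (1 / (z - p)))"

lemma inversion_at_simps [simp]:
  "inversion_at p None = Some 0"
  "inversion_at p (Some p) = None"
  "z \<noteq> p \<Longrightarrow> inversion_at p (Some z) = Some (1 / (z - p))"
  by (auto simp: inversion_at_def)

lemma homeomorphic_map_inversion_at:
  "homeomorphic_map riemann_sphere riemann_sphere (inversion_at p)"
proof (rule homeomorphic_map_riemann_sphere_if_continuous_bij)
  define inv where "inv x = (case x of None \<Rightarrow> Some p | Some w \<Rightarrow> if w = 0 then None else Some (p + 1 / w))" for x
  have "inv \<circ> inversion_at p = id" "inversion_at p \<circ> inv = id"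
    by (auto simp: fun_eq_iff inv_def inversion_at_def split: option.splits)
  then show "bij (inversion_at p)" using o_bij by blast
next
  fix U assume "openin riemann_sphere U"
  then have U: "open {w. Some w \<in> U}" "None \<in> U \<Longrightarrow> bounded {w. Some w \<notin> U}"
    by (auto simp: openin_riemann_sphere)
  let ?V = "inversion_at p -` U"
  have finite_part: "open {z. z \<noteq> p \<and> Some z \<in> ?V}"
  proof -
    have "open ((\<lambda>z. 1 / (z - p)) -` {w. Some w \<in> U} \<inter> - {p})"
      by (rule continuous_on_open_vimage[THEN iffD1, rule_format, OF _ _ U(1)])
         (auto intro!: continuous_intros)
    also have "(\<lambda>z. 1 / (z - p)) -` {w. Some w \<in> U} \<inter> - {p} = {z. z \<noteq> p \<and> Some z \<in> ?V}"
      by auto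
    finally show ?thesis .
  qed
  have "open {z. Some z \<in> ?V}"
  proof (cases "None \<in> U")
    case False
    then have "{z. Some z \<in> ?V} = {z. z \<noteq> p \<and> Some z \<in> ?V}" by auto
    then show ?thesis using finite_part by simp
  next
    case True
    then obtain B where B: "0 < B" "\<And>w. Some w \<notin> U \<Longrightarrow> cmod w \<le> B"
      using U(2) unfolding bounded_pos by blast
    have "Some z \<in> ?V" if "z \<in> ball p (1 / B)" for z
    proof (cases "z = p")
      case False
      have "cmod (1 / (z - p)) > B"
        using that False B(1) by (simp add: dist_norm norm_divide norm_minus_commute field_simps)
      then have "Some (1 / (z - p)) \<in> U" using B(2)[of "1 / (z - p)"] by linarith
      then show ?thesis using False by simp
    qed (use True in simp)
    then have "{z. Some z \<in> ?V} = {z. z \<noteq> p \<and> Some z \<in> ?V} \<union> ball p (1 / B)"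
      using True B(1) by auto
    then show ?thesis using finite_part by (simp add: open_Un)
  qed
  moreover have "bounded {z. Some z \<notin> ?V}" if "None \<in> ?V"
  proof -
    have "0 \<in> {w. Some w \<in> U}" using that by simp
    then obtain e where e: "0 < e" "\<And>w. cmod w < e \<Longrightarrow> Some w \<in> U"
      using U(1) unfolding open_contains_ball by (auto simp: subset_iff)
    have "cmod (z - p) \<le> 1 / e" if "Some z \<notin> ?V" for z
    proof (rule ccontr)
      assume *: "\<not> cmod (z - p) \<le> 1 / e"
      then have "z \<noteq> p" using e(1) by auto
      moreover have "cmod (1 / (z - p)) < e"
        using * e(1) \<open>z \<noteq> p\<close> by (simp add: norm_divide field_simps)
      ultimately show False using that e(2) by simp
    qed
    then have "{z. Some z \<notin> ?V} \<subseteq> cball p (1 / e)"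
      by (auto simp: dist_norm norm_minus_commute)
    then show ?thesis using bounded_cball bounded_subset by blast
  qed
  ultimately show "openin riemann_sphere ?V" by (simp add: openin_riemann_sphere)
qed

text \<open>Solving \<open>x + H x = v\<close> means finding the fixed point of the contraction \<open>x \<mapsto> v - H x\<close>. The identity
  plus \<open>H\<close> expands distances by at least the factor \<open>1 - k\<close>, which yields injectivity and properness.\<close>

lemma identity_plus_contraction:
  fixes H :: "'a::banach \<Rightarrow> 'a"
  assumes H: "k-lipschitz_on UNIV H" and "k < 1"
  shows "bij (\<lambda>w. w + H w)" "continuous_on UNIV (\<lambda>w. w + H w)"
    "bounded B \<Longrightarrow> bounded ((\<lambda>w. w + H w) -` B)"
proof -
  have "0 \<le> k" using H by (rule lipschitz_on_nonneg)
  show "continuous_on UNIV (\<lambda>w. w + H w)"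
    using lipschitz_on_continuous_on[OF H] by (intro continuous_intros)
  have expand: "(1 - k) * norm (x - y) \<le> norm ((x + H x) - (y + H y))" for x y
    using lipschitz_on_normD[OF H, of x y] norm_diff_ineq[of "x - y" "H x - H y"]
    by (simp add: algebra_simps)
  show "bij (\<lambda>w. w + H w)"
  proof (rule bijI)
    show "inj (\<lambda>w. w + H w)"
    proof (rule injI)
      fix x y assume "x + H x = y + H y"
      then show "x = y" using expand[of x y] \<open>k < 1\<close> by (simp add: mult_le_0_iff)
    qed
    show "surj (\<lambda>w. w + H w)"
    proof (rule surjI)
      fix v
      have dist_diff_same_left: "dist (v - H x) (v - H y) = dist (H x) (H y)" for x y
        by (simp add: dist_norm norm_minus_commute)
      have "\<exists>!x. v - H x = x"
        by (rule banach_fix_type[OF \<open>0 \<le> k\<close> \<open>k < 1\<close>])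
           (use lipschitz_onD[OF H] in \<open>simp add: dist_diff_same_left\<close>)
      from theI'[OF this] show "(THE x. v - H x = x) + H (THE x. v - H x = x) = v"
        by (simp add: diff_eq_eq)
    qed
  qed
  assume "bounded B"
  then obtain b where b: "\<And>x. x \<in> B \<Longrightarrow> norm x \<le> b" unfolding bounded_iff by blast
  have "norm x \<le> (b + norm (H 0)) / (1 - k)" if "x + H x \<in> B" for x
    using expand[of x 0] b[OF that] norm_triangle_ineq4[of "x + H x" "H 0"] \<open>k < 1\<close>
    by (simp add: field_simps)
  then show "bounded ((\<lambda>w. w + H w) -` B)" unfolding bounded_iff by blast
qed

section \<open>Reflection in the unit circle, seen from the pole\<close>

text \<open>With \<open>z = p + 1 / w\<close> one has \<open>1 + p w = z w\<close>, so the test \<open>\<bar>w\<bar> \<le> \<bar>1 + p w\<bar>\<close> says \<open>\<bar>z\<bar> \<ge> 1\<close>, and in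
  that case the value is \<open>1 / cnj z\<close>, the mirror image of \<open>z\<close> in the unit circle. Written this way,
  the formula also covers \<open>w = 0\<close>, where \<open>z\<close> is infinity and its mirror image is \<open>0\<close>.\<close>

definition reflected_preimage :: "real \<Rightarrow> complex \<Rightarrow> complex" where
  "reflected_preimage p w =
    (if cmod w \<le> cmod (1 + of_real p * w) then cnj (w / (1 + of_real p * w)) else of_real p + 1 / w)"

lemma reflected_preimage_inverse:
  assumes "z \<noteq> of_real p"
  shows "reflected_preimage p (1 / (z - of_real p)) = (if 1 \<le> cmod z then 1 / cnj z else z)"
proof -
  define w where "w = 1 / (z - of_real p)"
  have w: "w \<noteq> 0" "1 + of_real p * w = z * w" "of_real p + 1 / w = z"
    using assms by (auto simp: w_def field_simps)
  show ?thesis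
    using w(1) unfolding w_def[symmetric] reflected_preimage_def w(2,3)
    by (auto simp: norm_mult field_simps)
qed

lemma reflected_preimage_denominators:
  "cmod w \<le> cmod (1 + of_real p * w) \<Longrightarrow> 1 + of_real p * w \<noteq> 0"
  "cmod (1 + of_real p * w) \<le> cmod w \<Longrightarrow> w \<noteq> 0"
  by auto

lemma norm_reflected_preimage:
  "cmod (reflected_preimage p w) = 
    (if cmod w \<le> cmod (1 + of_real p * w) then cmod w / cmod (1 + of_real p * w)
     else cmod (1 + of_real p * w) / cmod w)"
proof (cases "cmod w \<le> cmod (1 + of_real p * w)")
  case False
  then have "w \<noteq> 0" by auto
  then have "of_real p + 1 / w = (1 + of_real p * w) / w" by (auto simp: field_simps)
  with False show ?thesis by (simp add: reflected_preimage_def norm_divide)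
qed (simp add: reflected_preimage_def norm_divide del: complex_cnj_divide)

text \<open>The two formulas agree on the common boundary because \<open>cnj q = 1 / q\<close> for \<open>\<bar>q\<bar> = 1\<close>.\<close>

lemma continuous_on_reflected_preimage: "continuous_on UNIV (reflected_preimage p)"
proof -
  have "continuous_on UNIV (\<lambda>w. if cmod w - cmod (1 + of_real p * w) \<le> 0
      then cnj (w / (1 + of_real p * w)) else of_real p + 1 / w)"
  proof (rule continuous_on_cases_le)
    fix w assume "cmod w - cmod (1 + of_real p * w) = 0"
    then have nz: "w \<noteq> 0" "1 + of_real p * w \<noteq> 0" and "cmod (w / (1 + of_real p * w)) = 1"
      using reflected_preimage_denominators[where w = w and p = p] by (auto simp: norm_divide)
    then have "cnj (w / (1 + of_real p * w)) * (w / (1 + of_real p * w)) = 1"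
      by (metis complex_norm_square mult.commute of_real_1 power_one)
    then have "cnj (w / (1 + of_real p * w)) = (1 + of_real p * w) / w"
      using nz by (metis divide_divide_eq_right divide_eq_0_iff mult_1 nonzero_eq_divide_eq)
    then show "cnj (w / (1 + of_real p * w)) = of_real p + 1 / w"
      using nz by (simp add: field_simps)
  qed (use reflected_preimage_denominators in \<open>auto intro!: continuous_intros simp del: complex_cnj_divide\<close>)
  also have "(\<lambda>w. if cmod w - cmod (1 + of_real p * w) \<le> 0
      then cnj (w / (1 + of_real p * w)) else of_real p + 1 / w) = reflected_preimage p"
    by (auto simp: reflected_preimage_def fun_eq_iff)
  finally show ?thesis .
qed

text \<open>The set of \<open>w\<close> with \<open>\<bar>w\<bar> = \<bar>1 + p w\<bar>\<close> is the image of the unit circle under \<open>z \<mapsto> 1 / (z - p)\<close>. Along a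
  line the difference of squares is a polynomial of degree two in the parameter, with leading
  coefficient \<open>(1 - p\<^sup>2) \<bar>d\<bar>\<^sup>2 \<noteq> 0\<close>.\<close>

lemma finite_line_reflection_circle:
  fixes p :: real and a d :: complex
  assumes "0 \<le> p" "p < 1" "d \<noteq> 0"
  shows "finite {t::real. a + t *\<^sub>R d \<in> {w. cmod w = cmod (1 + of_real p * w)}}"
proof -
  define c0 where "c0 = (Re a)\<^sup>2 + (Im a)\<^sup>2 - (1 + p * Re a)\<^sup>2 - (p * Im a)\<^sup>2"
  define c1 where "c1 = 2 * (Re a * Re d + Im a * Im d) - 2 * (1 + p * Re a) * (p * Re d)
    - 2 * p\<^sup>2 * Im a * Im d"
  define c2 where "c2 = (1 - p\<^sup>2) * ((Re d)\<^sup>2 + (Im d)\<^sup>2)"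
  have "p\<^sup>2 < 1" using assms by (simp add: power_less_one_iff)
  moreover have "(Re d)\<^sup>2 + (Im d)\<^sup>2 \<noteq> 0"
    using assms(3) by (simp add: complex_eq_iff sum_power2_eq_zero_iff)
  ultimately have "[:c0, c1, c2:] \<noteq> 0" by (simp add: c2_def)
  then have "finite {t. poly [:c0, c1, c2:] t = 0}" by (rule poly_roots_finite)
  moreover have "poly [:c0, c1, c2:] t = 0"
    if "cmod (a + t *\<^sub>R d) = cmod (1 + of_real p * (a + t *\<^sub>R d))" for t
  proof -
    have "(cmod (a + t *\<^sub>R d))\<^sup>2 - (cmod (1 + of_real p * (a + t *\<^sub>R d)))\<^sup>2 = 0"
      using that by simp
    moreover have "(cmod (a + t *\<^sub>R d))\<^sup>2 - (cmod (1 + of_real p * (a + t *\<^sub>R d)))\<^sup>2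
        = poly [:c0, c1, c2:] t"
      unfolding cmod_power2 c0_def c1_def c2_def by (simp add: power2_eq_square algebra_simps)
    ultimately show ?thesis by simp
  qed
  ultimately show ?thesis by (auto elim: rev_finite_subset)
qed

text \<open>In direction \<open>v\<close> the derivative has modulus \<open>\<bar>v\<bar> / \<bar>c\<bar>\<^sup>2\<close>, where \<open>c\<close> is the larger in modulus of \<open>w\<close> and \<open>1 + p w\<close>. These two
  cannot both be small: \<open>1 = (1 + p w) - p w\<close> gives \<open>1 \<le> (1 + p) \<bar>c\<bar>\<close>.\<close>

lemma reflected_preimage_derivative:
  assumes "0 \<le> p" "cmod w \<noteq> cmod (1 + of_real p * w)"
  shows "\<exists>D. (reflected_preimage p has_derivative D) (at w) \<and>
    (\<forall>v. cmod (D v) \<le> (1 + p)\<^sup>2 * cmod v)"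
proof -
  let ?q = "1 + of_real p * w"
  have "1 \<le> cmod ?q + p * cmod w"
    using norm_triangle_ineq4[of ?q "of_real p * w"] assms(1) by (simp add: norm_mult)
  then have ge: "1 \<le> (1 + p) * m" if "cmod ?q \<le> m" "cmod w \<le> m" for m
    using that mult_left_mono[OF that(2) assms(1)] by (simp add: distrib_right)
  have bound: "cmod (v / c\<^sup>2) \<le> (1 + p)\<^sup>2 * cmod v" if "1 \<le> (1 + p) * cmod c" for v c
  proof -
    have "c \<noteq> 0" using that by auto
    have "cmod v * 1 \<le> cmod v * ((1 + p) * cmod c)\<^sup>2"
      using that by (intro mult_left_mono) (auto simp: one_le_power)
    then have "cmod v \<le> (1 + p)\<^sup>2 * cmod v * (cmod c)\<^sup>2"
      by (simp add: power_mult_distrib mult_ac)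
    then show ?thesis using \<open>c \<noteq> 0\<close> by (simp add: norm_divide norm_power pos_divide_le_eq)
  qed
  consider (inside) "cmod w < cmod ?q" | (outside) "cmod ?q < cmod w" using assms(2) by linarith
  then show ?thesis
  proof cases
    case inside
    then have "?q \<noteq> 0" by auto
    have "((\<lambda>w. w / (1 + of_real p * w)) has_field_derivative 1 / ?q\<^sup>2) (at w)"
      using \<open>?q \<noteq> 0\<close> by (auto intro!: derivative_eq_intros simp: power2_eq_square field_simps)
    then have "((\<lambda>w. w / (1 + of_real p * w)) has_derivative (\<lambda>v. v / ?q\<^sup>2)) (at w)"
      by (rule has_derivative_eq_rhs[OF has_field_derivative_imp_has_derivative]) (simp add: fun_eq_iff)
    then have "((\<lambda>w. cnj (w / (1 + of_real p * w))) has_derivative (\<lambda>v. cnj (v / ?q\<^sup>2))) (at w)"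
      by (rule has_derivative_cnj)
    then have "(reflected_preimage p has_derivative (\<lambda>v. cnj (v / ?q\<^sup>2))) (at w)"
    proof (rule has_derivative_transform_within_open)
      show "open {w. cmod w < cmod (1 + of_real p * w)}"
        by (intro open_Collect_less continuous_intros)
    qed (use inside in \<open>auto simp: reflected_preimage_def\<close>)
    moreover have "cmod (cnj (v / ?q\<^sup>2)) \<le> (1 + p)\<^sup>2 * cmod v" for v
      using bound[of ?q v] ge[of "cmod ?q"] inside by (simp del: complex_cnj_divide)
    ultimately show ?thesis by blast
  next
    case outside
    then have "w \<noteq> 0" by auto
    have "((\<lambda>w. of_real p + 1 / w) has_field_derivative - 1 / w\<^sup>2) (at w)"
      using \<open>w \<noteq> 0\<close> by (auto intro!: derivative_eq_intros simp: power2_eq_square field_simps)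
    then have "((\<lambda>w. of_real p + 1 / w) has_derivative (\<lambda>v. - v / w\<^sup>2)) (at w)"
      by (rule has_derivative_eq_rhs[OF has_field_derivative_imp_has_derivative]) (simp add: fun_eq_iff)
    then have "(reflected_preimage p has_derivative (\<lambda>v. - v / w\<^sup>2)) (at w)"
    proof (rule has_derivative_transform_within_open)
      show "open {w. cmod (1 + of_real p * w) < cmod w}"
        by (intro open_Collect_less continuous_intros)
    qed (use outside in \<open>auto simp: reflected_preimage_def\<close>)
    moreover have "cmod (- v / w\<^sup>2) \<le> (1 + p)\<^sup>2 * cmod v" for v
      using bound[of w v] ge[of "cmod w"] outside by simp
    ultimately show ?thesis by blast
  qed
qed

lemma lipschitz_on_reflected_preimage:
  assumes "0 \<le> p" "p < 1"
  shows "((1 + p)\<^sup>2)-lipschitz_on UNIV (reflected_preimage p)"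
  using assms continuous_on_reflected_preimage finite_line_reflection_circle
    reflected_preimage_derivative
  by (intro lipschitz_on_UNIV_if_derivative_bounded_off_thin_set
      [where S = "{w. cmod w = cmod (1 + of_real p * w)}"]) auto

section \<open>The extension by reflection\<close>

lemma lipschitz_on_compact_inversion:
  fixes P :: complex
  assumes "compact K" "P \<notin> K"
  shows "\<exists>L. L-lipschitz_on K (\<lambda>z. 1 / (z - P))"
proof -
  obtain e where e: "0 < e" "\<And>z. z \<in> K \<Longrightarrow> e \<le> dist P z"
    using separate_point_closed[OF compact_imp_closed[OF assms(1)] assms(2)] by metis
  have "(1 / e\<^sup>2)-lipschitz_on K (\<lambda>z. 1 / (z - P))"
  proof (rule lipschitz_onI)
    fix x y assume "x \<in> K" "y \<in> K"
    then have le: "e \<le> cmod (x - P)" "e \<le> cmod (y - P)"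
      using e(2)[of x] e(2)[of y] by (simp_all add: dist_norm norm_minus_commute)
    then have "x \<noteq> P" "y \<noteq> P" using e(1) by auto
    then have "1 / (x - P) - 1 / (y - P) = (y - x) / ((x - P) * (y - P))"
      by (simp add: field_simps)
    then have "dist (1 / (x - P)) (1 / (y - P)) = cmod (x - y) / (cmod (x - P) * cmod (y - P))"
      by (simp add: dist_norm norm_divide norm_mult norm_minus_commute)
    also have "\<dots> \<le> cmod (x - y) / (e * e)"
      using le e(1) by (intro frac_le mult_mono) auto
    finally show "dist (1 / (x - P)) (1 / (y - P)) \<le> 1 / e\<^sup>2 * dist x y"
      by (simp add: dist_norm power2_eq_square)
  qed simp
  then show ?thesis ..
qed

lemma AE_norm_neq_1: "AE z in lborel. cmod z \<noteq> 1"
proof -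
  have "sphere 0 1 \<in> null_sets (lborel :: complex measure)"
    using negligible_sphere[of "0::complex" 1]
    by (simp add: negligible_iff_null_sets null_sets_completion_iff)
  then show ?thesis by (rule AE_I') auto
qed

text \<open>The extension is \<open>identity + H\<close> on the sphere preceded by the inversion at the pole.\<close>

lemma quasiconformal_extension:
  fixes p k :: real and g :: "complex \<Rightarrow> complex"
  assumes p: "0 \<le> p" "p < 1" and k: "0 \<le> k" "k < 1"
    and hol: "g holomorphic_on ball 0 1"
    and g': "\<And>z. z \<in> ball 0 1 \<Longrightarrow> cmod (deriv g z) \<le> k / (1 + p)\<^sup>2"
  shows "\<exists>F. quasiconformal k F \<and> F (Some (of_real p)) = None \<and>
    (\<forall>z \<in> ball 0 1 - {of_real p}. F (Some z) = Some (1 / (z - of_real p) + g z))"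
proof -
  define \<kappa> where "\<kappa> = k / (1 + p)\<^sup>2"
  define P where "P = complex_of_real p"
  have "0 \<le> \<kappa>" and \<kappa>: "\<kappa> * (1 + p)\<^sup>2 = k" using p k by (simp_all add: \<kappa>_def)
  have der_g: "(g has_field_derivative deriv g z) (at z)" if "cmod z < 1" for z
    using holomorphic_derivI[OF hol open_ball] that by simp
  have "\<kappa>-lipschitz_on (ball 0 1) g"
  proof (rule lipschitz_onI)
    fix x y :: complex assume "x \<in> ball 0 1" "y \<in> ball 0 1"
    then have "cmod (g x - g y) \<le> \<kappa> * cmod (x - y)"
      using field_differentiable_bound[of "ball 0 1" g "deriv g" \<kappa> x y] der_g g'
      by (auto simp: \<kappa>_def intro: has_field_derivative_at_within)
    then show "dist (g x) (g y) \<le> \<kappa> * dist x y" by (simp add: dist_norm)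
  qed fact
  from lipschitz_extend_closure[OF this] obtain gh where
    gh: "\<kappa>-lipschitz_on (cball 0 1) gh" and gh_eq: "\<And>z. cmod z < 1 \<Longrightarrow> gh z = g z"
    by auto
  define H where "H w = gh (reflected_preimage p w)" for w
  \<comment> \<open>The two Lipschitz constants multiply to \<open>k\<close>.\<close>
  have "range (reflected_preimage p) \<subseteq> cball 0 1"
    by (auto simp: norm_reflected_preimage divide_le_eq)
  then have H: "k-lipschitz_on UNIV H"
    unfolding H_def[abs_def] \<kappa>[symmetric]
    by (intro lipschitz_on_compose2 lipschitz_on_reflected_preimage p lipschitz_on_subset[OF gh])
  define \<Phi> where "\<Phi> w = w + H w" for w
  define F where "F = map_option \<Phi> \<circ> inversion_at P"
  note \<Phi> = identity_plus_contraction[OF H k(2), folded \<Phi>_def]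
  have homeo: "homeomorphic_map riemann_sphere riemann_sphere F"
    unfolding F_def
    by (rule homeomorphic_map_compose[OF homeomorphic_map_inversion_at homeomorphic_map_map_option])
       (use \<Phi> in blast)+
  have F_P: "F (Some P) = None" by (simp add: F_def)
  have F_Some: "F (Some z) = Some (\<Phi> (1 / (z - P)))" if "z \<noteq> P" for z
    using that by (simp add: F_def)
  have \<Phi>_inv: "\<Phi> (1 / (z - P)) = 1 / (z - P) + gh (if 1 \<le> cmod z then 1 / cnj z else z)"
    if "z \<noteq> P" for z
    using reflected_preimage_inverse[of z p] that by (simp add: \<Phi>_def H_def P_def)
  define G where "G z = the (F (Some z))" for z
  define \<Omega> where "\<Omega> = - {P}"
  have \<Omega>_eq: "{z. F (Some z) \<noteq> None} = \<Omega>"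
    using F_P F_Some by (auto simp: \<Omega>_def)
  have "open \<Omega>" by (simp add: \<Omega>_def open_Compl)
  have G_eq: "G z = \<Phi> (1 / (z - P))" if "z \<in> \<Omega>" for z
    using that F_Some by (simp add: G_def \<Omega>_def)
  \<comment> \<open>The Wirtinger derivatives of \<open>G\<close>. Their values on the circle, a null set, are chosen so that the
    dilatation bound holds there as well.\<close>
  define A where "A z = - 1 / (z - P)\<^sup>2 + (if cmod z < 1 then deriv g z else 0)" for z
  define B where "B z = (if 1 < cmod z then - deriv g (1 / cnj z) / (cnj z)\<^sup>2 else 0)" for z
  have deriv_G: "(G has_derivative (\<lambda>v. A z * v + B z * cnj v)) (at z)"
    if "z \<in> \<Omega>" "cmod z \<noteq> 1" for z
  proof -
    have "z \<noteq> P" using that by (simp add: \<Omega>_def)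
    then have inv: "((\<lambda>z. 1 / (z - P)) has_field_derivative - 1 / (z - P)\<^sup>2) (at z)"
      by (auto intro!: derivative_eq_intros simp: power2_eq_square field_simps)
    have "cmod z < 1 \<or> 1 < cmod z" using that(2) by linarith
    then consider "cmod z < 1" | "1 < cmod z" by blast
    then show ?thesis
    proof cases
      case 1
      have "((\<lambda>z. 1 / (z - P) + g z) has_derivative (*) (A z)) (at z)"
        using DERIV_add[OF inv der_g[OF 1]] 1 by (simp add: has_field_derivative_def A_def)
      then have "(G has_derivative (*) (A z)) (at z)"
      proof (rule has_derivative_transform_within_open)
        show "open (\<Omega> \<inter> ball 0 1)" using \<open>open \<Omega>\<close> by blast
      qed (use that 1 in \<open>auto simp: G_eq \<Phi>_inv gh_eq \<Omega>_def\<close>)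
      with 1 show ?thesis by (simp add: B_def)
    next
      case 2
      then have "z \<noteq> 0" "cmod (1 / cnj z) < 1" by (auto simp: norm_divide divide_less_eq)
      have "((\<lambda>\<zeta>. 1 / \<zeta>) has_field_derivative - 1 / (cnj z)\<^sup>2) (at (cnj z))"
        using \<open>z \<noteq> 0\<close> by (auto intro!: derivative_eq_intros simp: power2_eq_square)
      from DERIV_chain2[OF der_g[OF \<open>cmod (1 / cnj z) < 1\<close>] this]
      have "((\<lambda>\<zeta>. g (1 / \<zeta>)) has_derivative (*) (B z)) (at (cnj z))"
        using 2 by (simp add: has_field_derivative_def B_def)
      note has_derivative_compose[OF has_derivative_cnj[OF has_derivative_ident] this]
      from has_derivative_add[OF has_field_derivative_imp_has_derivative[OF inv] this]
      have "((\<lambda>z. 1 / (z - P) + g (1 / cnj z)) has_derivative (\<lambda>v. A z * v + B z * cnj v)) (at z)"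
        by (rule has_derivative_eq_rhs) (use 2 in \<open>simp add: A_def fun_eq_iff\<close>)
      then show ?thesis
      proof (rule has_derivative_transform_within_open)
        show "open (\<Omega> \<inter> - cball 0 1)" using \<open>open \<Omega>\<close> by (simp add: open_Int open_Compl)
      next
        fix x assume "x \<in> \<Omega> \<inter> - cball 0 1"
        then have "x \<in> \<Omega>" "x \<noteq> P" "1 < cmod x" by (auto simp: \<Omega>_def)
        moreover then have "cmod (1 / cnj x) < 1" by (simp add: norm_divide divide_less_eq)
        ultimately show "1 / (x - P) + g (1 / cnj x) = G x"
          by (simp add: G_eq \<Phi>_inv gh_eq)
      qed (use that 2 in auto)
    qed
  qed
  have lip_G: "\<exists>L. L-lipschitz_on K G" if "compact K" "K \<subseteq> \<Omega>" for K
  proof -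
    have "P \<notin> K" using that by (auto simp: \<Omega>_def)
    then obtain L where L: "L-lipschitz_on K (\<lambda>z. 1 / (z - P))"
      using lipschitz_on_compact_inversion \<open>compact K\<close> by metis
    have "(1 + k)-lipschitz_on ((\<lambda>z. 1 / (z - P)) ` K) \<Phi>"
      unfolding \<Phi>_def[abs_def]
      by (intro lipschitz_on_add lipschitz_on_subset[OF H]) (auto intro: lipschitz_onI)
    with L have "((1 + k) * L)-lipschitz_on K (\<lambda>z. \<Phi> (1 / (z - P)))"
      by (rule lipschitz_on_compose2)
    then have "((1 + k) * L)-lipschitz_on K G"
      by (rule lipschitz_on_transform) (use G_eq that in auto)
    then show ?thesis ..
  qed
  have A_meas: "A \<in> borel_measurable borel"
  proof -
    have "continuous_on (ball 0 1) (deriv g)"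
      using holomorphic_deriv[OF hol] holomorphic_on_imp_continuous_on by blast
    then have "(\<lambda>z. indicator (ball 0 1) z *\<^sub>R deriv g z) \<in> borel_measurable borel"
      by (rule borel_measurable_continuous_on_indicator[rotated]) simp
    then have "(\<lambda>z. - 1 / (z - P)\<^sup>2 + indicator (ball 0 1) z *\<^sub>R deriv g z) \<in> borel_measurable borel"
      by measurable
    also have "(\<lambda>z. - 1 / (z - P)\<^sup>2 + indicator (ball 0 1) z *\<^sub>R deriv g z) = A"
      by (auto simp: A_def fun_eq_iff indicator_def)
    finally show ?thesis .
  qed
  have B_meas: "B \<in> borel_measurable borel"
  proof -
    have "continuous_on (- cball 0 1) (\<lambda>z. - deriv g (1 / cnj z) / (cnj z)\<^sup>2)"
    proof -
      have "continuous_on (ball 0 1) (deriv g)"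
        using holomorphic_deriv[OF hol] holomorphic_on_imp_continuous_on by blast
      then have "continuous_on (- cball 0 1) (\<lambda>z. deriv g (1 / cnj z))"
        by (rule continuous_on_compose2) (auto intro!: continuous_intros simp: norm_divide divide_less_eq)
      then show ?thesis by (intro continuous_intros) auto
    qed
    then have "(\<lambda>z. indicator (- cball 0 1) z *\<^sub>R (- deriv g (1 / cnj z) / (cnj z)\<^sup>2)) \<in> borel_measurable borel"
      by (rule borel_measurable_continuous_on_indicator[rotated]) simp
    also have "(\<lambda>z. indicator (- cball 0 1) z *\<^sub>R (- deriv g (1 / cnj z) / (cnj z)\<^sup>2)) = B"
      by (auto simp: B_def fun_eq_iff indicator_def)
    finally show ?thesis .
  qed
  have B_le: "cmod (B z) \<le> \<kappa> / (cmod z)\<^sup>2" if "1 < cmod z" for z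
  proof -
    have "cmod (deriv g (1 / cnj z)) \<le> \<kappa>"
      unfolding \<kappa>_def by (rule g') (use that in \<open>simp add: norm_divide divide_less_eq\<close>)
    then have "cmod (deriv g (1 / cnj z)) / (cmod z)\<^sup>2 \<le> \<kappa> / (cmod z)\<^sup>2"
      by (rule divide_right_mono) simp
    then show ?thesis using that by (simp add: B_def norm_divide norm_power)
  qed
  have bound: "cmod (A z) + cmod (B z) \<le> 1 / (cmod (z - P))\<^sup>2 + \<kappa> + \<kappa>" for z
  proof -
    have "cmod (A z) \<le> 1 / (cmod (z - P))\<^sup>2 + \<kappa>"
      unfolding A_def
      by (rule norm_triangle_mono) (use g'[of z] \<open>0 \<le> \<kappa>\<close> in \<open>auto simp: \<kappa>_def norm_divide norm_power\<close>)
    moreover have "cmod (B z) \<le> \<kappa>"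
    proof (cases "1 < cmod z")
      case True
      then have "\<kappa> / (cmod z)\<^sup>2 \<le> \<kappa> / 1"
        using \<open>0 \<le> \<kappa>\<close> by (intro divide_left_mono) (auto simp: one_le_power)
      with B_le[OF True] show ?thesis by simp
    qed (simp add: B_def \<open>0 \<le> \<kappa>\<close>)
    ultimately show ?thesis by simp
  qed
  have dilatation: "cmod (B z) \<le> k * cmod (A z)" for z
  proof (cases "1 < cmod z")
    case True
    show ?thesis
    proof (cases "z = P")
      case True
      with \<open>1 < cmod z\<close> p show ?thesis by (simp add: P_def)
    next
      case False
      \<comment> \<open>For \<open>\<bar>z\<bar> > 1\<close> the factor \<open>(1 + p)\<^sup>2\<close> of the hypothesis absorbs \<open>\<bar>z - p\<bar>\<^sup>2 / \<bar>z\<bar>\<^sup>2\<close>.\<close>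
      have "cmod (z - P) \<le> cmod z + p"
        using norm_triangle_ineq4[of z P] p by (simp add: P_def)
      also have "\<dots> \<le> (1 + p) * cmod z"
        using True p mult_left_mono[of 1 "cmod z" p] by (simp add: algebra_simps)
      finally have "(cmod (z - P))\<^sup>2 \<le> ((1 + p) * cmod z)\<^sup>2" by (simp add: power_mono)
      then have "\<kappa> * (cmod (z - P))\<^sup>2 \<le> \<kappa> * ((1 + p) * cmod z)\<^sup>2"
        using \<open>0 \<le> \<kappa>\<close> by (rule mult_left_mono)
      also have "\<dots> = k * (cmod z)\<^sup>2"
        unfolding \<kappa>[symmetric] by (simp add: power_mult_distrib)
      finally have *: "\<kappa> * (cmod (z - P))\<^sup>2 \<le> k * (cmod z)\<^sup>2" .
      have "0 < (cmod z)\<^sup>2" "0 < (cmod (z - P))\<^sup>2"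
        using True False by auto
      with * have "\<kappa> / (cmod z)\<^sup>2 \<le> k / (cmod (z - P))\<^sup>2"
        by (intro mult_imp_div_pos_le) (simp_all add: pos_le_divide_eq)
      with B_le[OF True] True show ?thesis by (simp add: A_def norm_divide norm_power)
    qed
  qed (simp add: B_def k)
  have "quasiconformal k F"
  proof (rule quasiconformal_if_locally_lipschitz[OF homeo \<Omega>_eq G_def \<open>open \<Omega>\<close> lip_G])
    show "AE z in lborel. z \<in> \<Omega> \<longrightarrow> (G has_derivative (\<lambda>v. A z * v + B z * cnj v)) (at z)"
      using AE_norm_neq_1 by eventually_elim (use deriv_G in blast)
    show "continuous_on \<Omega> (\<lambda>z. 1 / (cmod (z - P))\<^sup>2 + \<kappa> + \<kappa>)"
      by (intro continuous_intros) (auto simp: \<Omega>_def)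
  qed (use A_meas B_meas bound dilatation in auto)
  moreover have "F (Some z) = Some (1 / (z - P) + g z)" if "z \<in> ball 0 1 - {P}" for z
    using that by (simp add: F_Some \<Phi>_inv gh_eq)
  ultimately show ?thesis using F_P unfolding P_def by blast
qed

theorem theorem4:
  fixes p k :: real and f :: "complex \<Rightarrow> complex" and b :: "nat \<Rightarrow> complex"
  assumes "0 \<le> p" and "p < 1"
    and "f \<in> Sigma_class p"
    and "\<And>z. z \<in> ball 0 1 \<Longrightarrow> z \<noteq> of_real p \<Longrightarrow>
           (\<lambda>n. b n * z ^ n) sums (f z - 1 / (z - of_real p))"
    and "0 \<le> k" and "k < 1"
    and "\<And>z. z \<in> ball 0 1 \<Longrightarrow>
           cmod (if z = of_real p then 0 else (z - of_real p)\<^sup>2 * deriv f z + 1)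
             \<le> k * (cmod (z - of_real p))\<^sup>2 / (1 + p)\<^sup>2"
  shows "f \<in> Sigma_qc_class k p"
proof -
  define P where "P = complex_of_real p"
  define g where "g z = (\<Sum>n. b n * z ^ n)" for z
  have P: "P \<in> ball 0 1" using assms(1,2) by (simp add: P_def)
  have f_eq: "f z = 1 / (z - P) + g z" if "z \<in> ball 0 1 - {P}" for z
    using sums_unique[OF assms(4)[of z]] that by (simp add: P_def g_def algebra_simps)
  have "(\<lambda>n. b n * (z - 0) ^ n) sums g z" if "z \<in> ball 0 1" for z
  proof -
    \<comment> \<open>The expansion is given only off the pole, so convergence at \<open>z\<close> is drawn from a real point
      beyond both \<open>z\<close> and the pole.\<close>
    define x where "x = (1 + max p (cmod z)) / 2"
    have x: "cmod z < x" "p < x" "x < 1"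
      using that assms(1,2) by (auto simp: x_def max_def)
    have "summable (\<lambda>n. b n * of_real x ^ n)"
      using x assms(1) by (intro sums_summable[OF assms(4)]) auto
    then have "summable (\<lambda>n. b n * z ^ n)"
      by (rule powser_inside) (use x assms(1) in auto)
    then show ?thesis unfolding g_def by (simp add: summable_sums)
  qed
  then have hol: "g holomorphic_on ball 0 1"
    by (rule power_series_holomorphic)
  have le: "cmod (deriv g z) \<le> k / (1 + p)\<^sup>2" if "z \<in> ball 0 1 - {P}" for z
  proof -
    have "((\<lambda>z. 1 / (z - P) + g z) has_field_derivative - 1 / (z - P)\<^sup>2 + deriv g z) (at z)"
      using holomorphic_derivI[OF hol open_ball] that
      by (auto intro!: derivative_eq_intros simp: power2_eq_square)
    then have "(f has_field_derivative - 1 / (z - P)\<^sup>2 + deriv g z) (at z)"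
      by (rule has_field_derivative_transform_within_open[where S = "ball 0 1 - {P}"])
         (use that f_eq in auto)
    then have "(z - P)\<^sup>2 * deriv f z + 1 = (z - P)\<^sup>2 * deriv g z"
      using that by (simp add: DERIV_imp_deriv field_simps)
    then have "(cmod (z - P))\<^sup>2 * cmod (deriv g z) \<le> (cmod (z - P))\<^sup>2 * (k / (1 + p)\<^sup>2)"
      using assms(7)[of z] that
      by (simp add: P_def norm_mult norm_power mult.commute)
    then show ?thesis by (rule mult_left_le_imp_le) (use that in simp)
  qed
  have "cmod (deriv g z) \<le> k / (1 + p)\<^sup>2" if "z \<in> ball 0 1" for z
  proof (cases "z = P")
    case True
    have "isCont (deriv g) P"
      using holomorphic_on_imp_continuous_on[OF holomorphic_deriv[OF hol open_ball]] P
      by (meson continuous_on_eq_continuous_at open_ball)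
    then have "((\<lambda>z. cmod (deriv g z)) \<longlongrightarrow> cmod (deriv g P)) (at P)"
      by (simp add: isCont_def tendsto_norm)
    moreover have "\<forall>\<^sub>F z in at P. cmod (deriv g z) \<le> k / (1 + p)\<^sup>2"
      using eventually_at_in_open[OF open_ball P] by eventually_elim (use le in auto)
    ultimately show ?thesis
      using True by (intro tendsto_upperbound) auto
  qed (use le that in auto)
  from quasiconformal_extension[OF assms(1,2,5,6) hol this] obtain F where
    F: "quasiconformal k F" "F (Some P) = None"
    "\<And>z. z \<in> ball 0 1 - {P} \<Longrightarrow> F (Some z) = Some (1 / (z - P) + g z)"
    unfolding P_def by blast
  have "F (Some z) = sphere_map f z" if "z \<in> ball 0 1" for z
  proof (cases "z = P")
    case True
    then show ?thesis
      using F(2) assms(3) by (simp add: sphere_map_def Sigma_class_def P_def)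
  next
    case False
    have "f holomorphic_on ball 0 1 - {P}"
      by (rule holomorphic_transform[of "\<lambda>z. 1 / (z - P) + g z"])
         (use f_eq hol in \<open>auto intro!: holomorphic_intros intro: holomorphic_on_subset\<close>)
    then have "\<not> is_pole f z"
      using not_is_pole_holomorphic[of "ball 0 1 - {P}" z f] that False by (simp add: open_delete)
    then show ?thesis
      using F(3)[of z] f_eq[of z] that False by (simp add: sphere_map_def)
  qed
  with F(1) assms(3) show ?thesis unfolding Sigma_qc_class_def by blast
qed

end
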